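(* If Sullivan's conjecture is false (i.e. if there exists at least one counterexample to it), then there exists $k\in\mathbb{N}$ for which there are strongly connected counterexamples to Sullivan's conjecture with arbitrarily many vertices and with maximum out-degree $\Delta^+\le k$. Moreover, there are also counterexamples $O$ (with arbitrarily many vertices) whose minimum out-degree satisfies $\delta^+\ge\frac{n}{2}-k$, where $n=|V(O)|$.
   Context: All directed graphs are finite, with non-empty vertex set, and without loops or multiple arcs. An orientation (oriented graph) is a directed graph with no directed cycle of length 2. For a directed graph $G$ and $v\in V(G)$: $N^+_1(G,v)=\{w : (v,w)\in E(G)\}$, $N^-_1(G,v)=\{u : (u,v)\in E(G)\}$, and $N^+_2(G,v)=\{w\in V(G)\setminus(N^+_1(G,v)\cup\{v\}) : \exists u\in N^+_1(G,v),\ (u,w)\in E(G)\}$. Sullivan's conjecture states that every oriented graph $G$ contains a vertex $v$ with $|N^+_2(G,v)|\ge|N^-_1(G,v)|$. A counterexample is an orientation $G$ with $|N^+_2(G,v)|<|N^-_1(G,v)|$ for all $v\in V(G)$. $\Delta^+$ and $\delta^+$ denote the maximum and minimum of $|N^+_1(O,v)|$ over the vertices $v$ of $O$. A directed graph is strongly connected if for any two vertices $u,v$ there are directed walks from $u$ to $v$ and from $v$ to $u$. "With arbitrarily many vertices" means that for every $N$ there is such a counterexample with at least $N$ vertices. *)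

theory Defs
  imports Complex_Main "Graph_Theory.Digraph_Component"
begin

definition oriented_graph :: "'a pair_pre_digraph \<Rightarrow> bool" where
  "oriented_graph G \<longleftrightarrow>
     pair_digraph G \<and> pverts G \<noteq> {} \<and>
     (\<forall>u v. (u, v) \<in> parcs G \<longrightarrow> (v, u) \<notin> parcs G)"

definition out_nbhd :: "'a pair_pre_digraph \<Rightarrow> 'a \<Rightarrow> 'a set" where
  "out_nbhd G v = {w. (v, w) \<in> parcs G}"

definition in_nbhd :: "'a pair_pre_digraph \<Rightarrow> 'a \<Rightarrow> 'a set" where
  "in_nbhd G v = {u. (u, v) \<in> parcs G}"

definition second_out_nbhd :: "'a pair_pre_digraph \<Rightarrow> 'a \<Rightarrow> 'a set" where
  "second_out_nbhd G v =
     {w \<in> pverts G - (out_nbhd G v \<union> {v}). \<exists>u \<in> out_nbhd G v. (u, w) \<in> parcs G}"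

definition max_out_degree :: "'a pair_pre_digraph \<Rightarrow> nat" where
  "max_out_degree G = Max ((\<lambda>v. card (out_nbhd G v)) ` pverts G)"

definition min_out_degree :: "'a pair_pre_digraph \<Rightarrow> nat" where
  "min_out_degree G = Min ((\<lambda>v. card (out_nbhd G v)) ` pverts G)"

text \<open>Sullivan's conjecture for graphs with vertices in a given type; for any infinite
  type this is the conjecture for all finite oriented graphs.\<close>

definition sullivan_conjecture :: "'a itself \<Rightarrow> bool" where
  "sullivan_conjecture (_ :: 'a itself) \<longleftrightarrow>
     (\<forall>G :: 'a pair_pre_digraph. oriented_graph G \<longrightarrow>
        (\<exists>v \<in> pverts G. card (second_out_nbhd G v) \<ge> card (in_nbhd G v)))"

definition sullivan_counterexample :: "'a pair_pre_digraph \<Rightarrow> bool" where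
  "sullivan_counterexample G \<longleftrightarrow>
     oriented_graph G \<and>
     (\<forall>v \<in> pverts G. card (second_out_nbhd G v) < card (in_nbhd G v))"

end

theory Submission
  imports Defs "HOL-Library.Countable"
begin

text \<open>
  Replacing every vertex of a counterexample by two independent copies doubles all the
  neighbourhoods involved, so \<open>|N\<^sup>-\<^sub>1| - |N\<^sup>+\<^sub>2|\<close> becomes at least \<open>2\<close>.
  A smallest graph with that surplus is strongly connected, since a set of vertices closed under
  in-neighbours induces a graph with the same surplus. Arrange copies \<open>G\<^sub>i\<close> of it
  in a ring and join \<open>G\<^sub>i\<close> to \<open>G\<^sub>i\<^sub>+\<^sub>1\<close> through
  a new vertex \<open>z\<^sub>i\<close>, with arcs from all of \<open>G\<^sub>i\<close> to \<open>z\<^sub>i\<close> and one arc from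
  \<open>z\<^sub>i\<close> to a vertex of \<open>G\<^sub>i\<^sub>+\<^sub>1\<close>: each old vertex gains a single second
  out-neighbour, which the surplus pays for, and \<open>z\<^sub>i\<close> has in-degree \<open>|G|\<close>, which exceeds
  every out-degree in \<open>G\<close> by at least two. For large minimum out-degree, substitute a counterexample for every
  vertex of a regular tournament \<open>T\<close>; in \<open>T\<close> itself \<open>|N\<^sup>+\<^sub>2| \<le> |N\<^sup>-\<^sub>1|\<close>.
\<close>

section \<open>Elementary facts on oriented graphs and their degrees\<close>

lemma oriented_graph_iff:
  "oriented_graph G \<longleftrightarrow> finite (pverts G) \<and> pverts G \<noteq> {} \<and>
     parcs G \<subseteq> pverts G \<times> pverts G \<and> (\<forall>u v. (u, v) \<in> parcs G \<longrightarrow> (v, u) \<notin> parcs G)"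
proof
  assume "oriented_graph G"
  then interpret pair_digraph G
    by (simp add: oriented_graph_def)
  show "finite (pverts G) \<and> pverts G \<noteq> {} \<and>
     parcs G \<subseteq> pverts G \<times> pverts G \<and> (\<forall>u v. (u, v) \<in> parcs G \<longrightarrow> (v, u) \<notin> parcs G)"
    using \<open>oriented_graph G\<close> pair_finite_verts
    by (auto simp: oriented_graph_def dest: in_arcsD1 in_arcsD2)
next
  assume *: "finite (pverts G) \<and> pverts G \<noteq> {} \<and>
     parcs G \<subseteq> pverts G \<times> pverts G \<and> (\<forall>u v. (u, v) \<in> parcs G \<longrightarrow> (v, u) \<notin> parcs G)"
  then have "finite (parcs G)"
    by (meson finite_SigmaI finite_subset)
  with * have "pair_digraph G"
    by unfold_locales (auto, metis)
  with * show "oriented_graph G"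
    by (simp add: oriented_graph_def)
qed

lemma oriented_graph_nbhds:
  assumes "oriented_graph G"
  shows "out_nbhd G v \<subseteq> pverts G" "in_nbhd G v \<subseteq> pverts G" "second_out_nbhd G v \<subseteq> pverts G"
    and "finite (out_nbhd G v)" "finite (in_nbhd G v)" "finite (second_out_nbhd G v)"
proof -
  show "out_nbhd G v \<subseteq> pverts G" "in_nbhd G v \<subseteq> pverts G" "second_out_nbhd G v \<subseteq> pverts G"
    using assms by (auto simp: oriented_graph_iff out_nbhd_def in_nbhd_def second_out_nbhd_def)
  then show "finite (out_nbhd G v)" "finite (in_nbhd G v)" "finite (second_out_nbhd G v)"
    using assms by (auto simp: oriented_graph_iff intro: finite_subset)
qed

text \<open>The two neighbourhoods are disjoint, as there are no 2-cycles, and both avoid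
  \<open>v\<close>. This later compares the out-degree of \<open>r\<close> with the in-degree of a
  connector.\<close>

lemma oriented_graph_degree_sum:
  assumes "oriented_graph G" "v \<in> pverts G"
  shows "card (out_nbhd G v) + card (in_nbhd G v) < card (pverts G)"
proof -
  note nb = oriented_graph_nbhds[OF assms(1)]
  have "out_nbhd G v \<inter> in_nbhd G v = {}"
    using assms(1) by (auto simp: oriented_graph_iff out_nbhd_def in_nbhd_def)
  then have "card (out_nbhd G v) + card (in_nbhd G v) = card (out_nbhd G v \<union> in_nbhd G v)"
    using nb by (simp add: card_Un_disjoint)
  also have "\<dots> < card (pverts G)"
  proof (rule psubset_card_mono)
    show "finite (pverts G)"
      using assms(1) by (simp add: oriented_graph_iff)
    have "v \<notin> out_nbhd G v \<union> in_nbhd G v"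
      using assms(1) by (auto simp: oriented_graph_iff out_nbhd_def in_nbhd_def)
    with assms(2) nb show "out_nbhd G v \<union> in_nbhd G v \<subset> pverts G"
      by blast
  qed
  finally show ?thesis .
qed

text \<open>The inequality is strict, so \<open>c = 0\<close> describes counterexamples and
  \<open>c = 1\<close> is the surplus of two on which the ring construction relies.\<close>

definition has_surplus :: "nat \<Rightarrow> 'a pair_pre_digraph \<Rightarrow> bool" where
  "has_surplus c G \<longleftrightarrow> oriented_graph G \<and>
     (\<forall>v \<in> pverts G. card (second_out_nbhd G v) + c < card (in_nbhd G v))"

lemma sullivan_counterexample_iff: "sullivan_counterexample G \<longleftrightarrow> has_surplus 0 G"
  by (simp add: sullivan_counterexample_def has_surplus_def)

lemma has_surplus_mono: "has_surplus c G \<Longrightarrow> d \<le> c \<Longrightarrow> has_surplus d G"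
  by (fastforce simp: has_surplus_def)

text \<open>Reachability in a digraph is \<open>rtrancl_on\<close> its vertex set; all arcs have
  both ends in that set, so the plain closure is enough.\<close>

lemma strongly_connected_with_projI:
  assumes "oriented_graph G"
    and "\<And>u v. u \<in> pverts G \<Longrightarrow> v \<in> pverts G \<Longrightarrow> (u, v) \<in> (parcs G)\<^sup>*"
  shows "strongly_connected (with_proj G)"
proof
  show "verts (with_proj G) \<noteq> {}"
    using assms(1) by (simp add: oriented_graph_iff)
  fix u v
  assume "u \<in> verts (with_proj G)" "v \<in> verts (with_proj G)"
  then have "(u, v) \<in> (parcs G)\<^sup>*" "u \<in> pverts G"
    using assms(2) by auto
  then have "(u, v) \<in> rtrancl_on (pverts G) (parcs G)"
  proof induction
    case (step y z)
    then show ?case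
      using assms(1) by (auto simp: oriented_graph_iff intro: rtrancl_on_into_rtrancl_on)
  qed simp
  then show "u \<rightarrow>\<^sup>*\<^bsub>with_proj G\<^esub> v"
    by (simp add: reachable_def)
qed

section \<open>Relabelling\<close>

text \<open>The constructions change the vertex type, while the final graphs must live on
  \<open>nat\<close>.\<close>

definition map_graph :: "('a \<Rightarrow> 'b) \<Rightarrow> 'a pair_pre_digraph \<Rightarrow> 'b pair_pre_digraph" where
  "map_graph f G = \<lparr>pverts = f ` pverts G, parcs = map_prod f f ` parcs G\<rparr>"

lemma pverts_map_graph [simp]: "pverts (map_graph f G) = f ` pverts G"
  by (simp add: map_graph_def)

context
  fixes G :: "'a pair_pre_digraph" and f :: "'a \<Rightarrow> 'b"
  assumes G: "oriented_graph G" and f: "inj_on f (pverts G)"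
begin

lemma parcs_map_graph_iff:
  assumes "u \<in> pverts G" "v \<in> pverts G"
  shows "(f u, f v) \<in> parcs (map_graph f G) \<longleftrightarrow> (u, v) \<in> parcs G"
proof
  assume "(f u, f v) \<in> parcs (map_graph f G)"
  then obtain a b where ab: "(a, b) \<in> parcs G" "f u = f a" "f v = f b"
    by (auto simp: map_graph_def)
  then have "a \<in> pverts G" "b \<in> pverts G"
    using G by (auto simp: oriented_graph_iff)
  with ab assms f show "(u, v) \<in> parcs G"
    by (metis inj_onD)
qed (force simp: map_graph_def)

lemma parcs_map_graphE:
  assumes "(x, y) \<in> parcs (map_graph f G)"
  obtains u v where "x = f u" "y = f v" "u \<in> pverts G" "v \<in> pverts G" "(u, v) \<in> parcs G"
  using assms G by (auto simp: oriented_graph_iff map_graph_def)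

lemma oriented_map_graph: "oriented_graph (map_graph f G)"
proof -
  have "parcs (map_graph f G) \<subseteq> pverts (map_graph f G) \<times> pverts (map_graph f G)"
    by (auto elim: parcs_map_graphE)
  moreover have "(y, x) \<notin> parcs (map_graph f G)" if "(x, y) \<in> parcs (map_graph f G)" for x y
    using that G by (elim parcs_map_graphE) (simp add: parcs_map_graph_iff oriented_graph_iff)
  ultimately show ?thesis
    using G by (simp add: oriented_graph_iff)
qed

lemma out_nbhd_map_graph:
  assumes "v \<in> pverts G"
  shows "out_nbhd (map_graph f G) (f v) = f ` out_nbhd G v"
proof
  show "out_nbhd (map_graph f G) (f v) \<subseteq> f ` out_nbhd G v"
  proof
    fix x
    assume "x \<in> out_nbhd (map_graph f G) (f v)"
    then have "(f v, x) \<in> parcs (map_graph f G)"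
      by (simp add: out_nbhd_def)
    moreover from this obtain w where w: "x = f w" "w \<in> pverts G"
      by (rule parcs_map_graphE)
    ultimately show "x \<in> f ` out_nbhd G v"
      using assms by (simp add: out_nbhd_def parcs_map_graph_iff)
  qed
  show "f ` out_nbhd G v \<subseteq> out_nbhd (map_graph f G) (f v)"
    by (force simp: out_nbhd_def map_graph_def)
qed

lemma in_nbhd_map_graph:
  assumes "v \<in> pverts G"
  shows "in_nbhd (map_graph f G) (f v) = f ` in_nbhd G v"
proof
  show "in_nbhd (map_graph f G) (f v) \<subseteq> f ` in_nbhd G v"
  proof
    fix x
    assume "x \<in> in_nbhd (map_graph f G) (f v)"
    then have "(x, f v) \<in> parcs (map_graph f G)"
      by (simp add: in_nbhd_def)
    moreover from this obtain w where w: "x = f w" "w \<in> pverts G"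
      by (rule parcs_map_graphE)
    ultimately show "x \<in> f ` in_nbhd G v"
      using assms by (simp add: in_nbhd_def parcs_map_graph_iff)
  qed
  show "f ` in_nbhd G v \<subseteq> in_nbhd (map_graph f G) (f v)"
    by (force simp: in_nbhd_def map_graph_def)
qed

text \<open>Second neighbourhoods stand only on the smaller side of \<open>has_surplus\<close>,
  hence an inclusion in this direction.\<close>

lemma second_out_nbhd_map_graph:
  assumes "v \<in> pverts G"
  shows "second_out_nbhd (map_graph f G) (f v) \<subseteq> f ` second_out_nbhd G v"
proof
  fix w
  assume w: "w \<in> second_out_nbhd (map_graph f G) (f v)"
  then obtain w' where w': "w = f w'" "w' \<in> pverts G"
    by (auto simp: second_out_nbhd_def)
  with w obtain u where "u \<in> out_nbhd G v" "(f u, f w') \<in> parcs (map_graph f G)"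
    "w' \<notin> out_nbhd G v" "w' \<noteq> v"
    using assms by (auto simp: second_out_nbhd_def out_nbhd_map_graph)
  moreover from this have "(u, w') \<in> parcs G"
    using w' oriented_graph_nbhds(1)[OF G] parcs_map_graph_iff by blast
  ultimately show "w \<in> f ` second_out_nbhd G v"
    using w' by (auto simp: second_out_nbhd_def)
qed

lemma card_map_graph:
  assumes "A \<subseteq> pverts G"
  shows "card (f ` A) = card A"
  using assms f by (meson card_image inj_on_subset)

lemma has_surplus_map_graph:
  assumes "has_surplus c G"
  shows "has_surplus c (map_graph f G)"
  unfolding has_surplus_def
proof (intro conjI ballI)
  fix x
  assume "x \<in> pverts (map_graph f G)"
  then obtain v where v: "x = f v" "v \<in> pverts G"
    by auto
  note nb = oriented_graph_nbhds[OF G, of v]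
  have "card (second_out_nbhd (map_graph f G) x) \<le> card (second_out_nbhd G v)"
    unfolding v(1) using second_out_nbhd_map_graph[OF v(2)] nb(6) by (rule surj_card_le[rotated])
  moreover have "card (in_nbhd (map_graph f G) x) = card (in_nbhd G v)"
    using v nb by (simp add: in_nbhd_map_graph card_map_graph)
  ultimately show "card (second_out_nbhd (map_graph f G) x) + c < card (in_nbhd (map_graph f G) x)"
    using assms v(2) by (fastforce simp: has_surplus_def)
qed (rule oriented_map_graph)

lemma out_degrees_map_graph:
  "(\<lambda>v. card (out_nbhd (map_graph f G) v)) ` pverts (map_graph f G) =
     (\<lambda>v. card (out_nbhd G v)) ` pverts G"
  unfolding pverts_map_graph image_image
  by (intro image_cong refl)
    (simp add: out_nbhd_map_graph card_map_graph oriented_graph_nbhds(1)[OF G])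

lemma max_out_degree_map_graph: "max_out_degree (map_graph f G) = max_out_degree G"
  by (simp only: max_out_degree_def out_degrees_map_graph)

lemma min_out_degree_map_graph: "min_out_degree (map_graph f G) = min_out_degree G"
  by (simp only: min_out_degree_def out_degrees_map_graph)

end

lemma rtrancl_map_graph:
  assumes "(u, v) \<in> (parcs G)\<^sup>*"
  shows "(f u, f v) \<in> (parcs (map_graph f G))\<^sup>*"
  using assms
proof induction
  case (step y z)
  then have "(f y, f z) \<in> parcs (map_graph f G)"
    by (force simp: map_graph_def)
  with step.IH show ?case
    by (rule rtrancl_into_rtrancl)
qed simp

section \<open>Lexicographic products\<close>

text \<open>This is the substitution of a copy of \<open>H\<close> for every vertex of
  \<open>G\<close>: the first coordinate names the copy.\<close>

definition lex_prod_graph ::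
    "'a pair_pre_digraph \<Rightarrow> 'b pair_pre_digraph \<Rightarrow> ('a \<times> 'b) pair_pre_digraph" where
  "lex_prod_graph G H = \<lparr>pverts = pverts G \<times> pverts H,
     parcs = {((a, x), (b, y)) | a b x y. x \<in> pverts H \<and> y \<in> pverts H \<and> (a, b) \<in> parcs G \<or>
       a \<in> pverts G \<and> a = b \<and> (x, y) \<in> parcs H}\<rparr>"

lemma pverts_lex_prod_graph [simp]: "pverts (lex_prod_graph G H) = pverts G \<times> pverts H"
  by (simp add: lex_prod_graph_def)

lemma parcs_lex_prod_graph_iff:
  "((a, x), (b, y)) \<in> parcs (lex_prod_graph G H) \<longleftrightarrow>
     x \<in> pverts H \<and> y \<in> pverts H \<and> (a, b) \<in> parcs G \<or> a \<in> pverts G \<and> a = b \<and> (x, y) \<in> parcs H"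
  by (simp add: lex_prod_graph_def)

context
  fixes G :: "'a pair_pre_digraph" and H :: "'b pair_pre_digraph"
  assumes G: "oriented_graph G" and H: "oriented_graph H"
begin

lemma oriented_lex_prod_graph: "oriented_graph (lex_prod_graph G H)"
  using G H unfolding oriented_graph_iff
  by (auto simp: parcs_lex_prod_graph_iff)

text \<open>The common shape of the neighbourhoods of \<open>(a, x)\<close>: full copies of
  \<open>H\<close> over a neighbourhood \<open>A\<close> of \<open>a\<close>, and a part
  \<open>B\<close> of its own copy.\<close>

lemma card_lex_prod_nbhd:
  assumes "a \<notin> A" "finite A" "finite B"
  shows "card (A \<times> pverts H \<union> {a} \<times> B) = card A * card (pverts H) + card B"
  using assms H by (subst card_Un_disjoint) (auto simp: oriented_graph_iff card_cartesian_product)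

context
  fixes a x
  assumes ax: "a \<in> pverts G" "x \<in> pverts H"
begin

lemma card_out_nbhd_lex_prod_graph:
  "card (out_nbhd (lex_prod_graph G H) (a, x)) =
     card (out_nbhd G a) * card (pverts H) + card (out_nbhd H x)"
proof -
  have "out_nbhd (lex_prod_graph G H) (a, x) = out_nbhd G a \<times> pverts H \<union> {a} \<times> out_nbhd H x"
    using ax by (auto simp: out_nbhd_def parcs_lex_prod_graph_iff)
  moreover have "a \<notin> out_nbhd G a"
    using G by (auto simp: oriented_graph_iff out_nbhd_def)
  ultimately show ?thesis
    using oriented_graph_nbhds[OF G] oriented_graph_nbhds[OF H] by (simp add: card_lex_prod_nbhd)
qed

lemma card_in_nbhd_lex_prod_graph:
  "card (in_nbhd (lex_prod_graph G H) (a, x)) =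
     card (in_nbhd G a) * card (pverts H) + card (in_nbhd H x)"
proof -
  have "in_nbhd (lex_prod_graph G H) (a, x) = in_nbhd G a \<times> pverts H \<union> {a} \<times> in_nbhd H x"
    using ax by (auto simp: in_nbhd_def parcs_lex_prod_graph_iff)
  moreover have "a \<notin> in_nbhd G a"
    using G by (auto simp: oriented_graph_iff in_nbhd_def)
  ultimately show ?thesis
    using oriented_graph_nbhds[OF G] oriented_graph_nbhds[OF H] by (simp add: card_lex_prod_nbhd)
qed

text \<open>A 2-step path leaving the copy of \<open>a\<close> cannot return to it, since
  \<open>G\<close> has no 2-cycles. If just one of its steps stays inside a copy, it ends at a first
  out-neighbour. The other paths project to 2-step paths in \<open>G\<close> or in
  \<open>H\<close>.\<close>

lemma card_second_out_nbhd_lex_prod_graph: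
  "card (second_out_nbhd (lex_prod_graph G H) (a, x)) \<le>
     card (second_out_nbhd G a) * card (pverts H) + card (second_out_nbhd H x)"
proof -
  have "second_out_nbhd (lex_prod_graph G H) (a, x) \<subseteq>
      second_out_nbhd G a \<times> pverts H \<union> {a} \<times> second_out_nbhd H x"
    using ax G
    by (auto simp: second_out_nbhd_def out_nbhd_def parcs_lex_prod_graph_iff oriented_graph_iff)
  moreover have "a \<notin> second_out_nbhd G a"
    by (simp add: second_out_nbhd_def)
  moreover have "finite (pverts H)"
    using H by (simp add: oriented_graph_iff)
  ultimately show ?thesis
    using oriented_graph_nbhds[OF G, of a] oriented_graph_nbhds[OF H, of x]
    by (subst card_lex_prod_nbhd[symmetric]) (auto intro: card_mono)
qed

end

end

lemma has_surplus_double: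
  assumes "has_surplus 0 G"
  shows "has_surplus 1 (lex_prod_graph G \<lparr>pverts = UNIV :: bool set, parcs = {}\<rparr>)"
    (is "has_surplus 1 (lex_prod_graph G ?D)")
  unfolding has_surplus_def
proof (intro conjI ballI)
  have G: "oriented_graph G"
    using assms by (simp add: has_surplus_def)
  have D: "oriented_graph ?D"
    by (simp add: oriented_graph_iff)
  show "oriented_graph (lex_prod_graph G ?D)"
    using G D by (rule oriented_lex_prod_graph)
  fix v
  assume "v \<in> pverts (lex_prod_graph G ?D)"
  then obtain a x where v: "v = (a, x)" "a \<in> pverts G" "x \<in> pverts ?D"
    by auto
  have "card (second_out_nbhd ?D x) = 0"
    by (simp add: second_out_nbhd_def out_nbhd_def)
  moreover have "card (second_out_nbhd G a) < card (in_nbhd G a)"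
    using assms v by (simp add: has_surplus_def)
  ultimately show "card (second_out_nbhd (lex_prod_graph G ?D) v) + 1
      < card (in_nbhd (lex_prod_graph G ?D) v)"
    using card_second_out_nbhd_lex_prod_graph[OF G D v(2,3)]
      card_in_nbhd_lex_prod_graph[OF G D v(2,3)] v(1) by simp
qed

section \<open>Regular tournaments\<close>

text \<open>
  The vertex \<open>i\<close> beats the \<open>s\<close> vertices that follow it cyclically
  modulo \<open>2 * s + 1\<close>.
\<close>
definition rotational_tournament :: "nat \<Rightarrow> nat pair_pre_digraph" where
  "rotational_tournament s = \<lparr>pverts = {..2 * s},
     parcs = {(i, j) | i j. i \<le> 2 * s \<and> j \<le> 2 * s \<and> (i < j \<and> j \<le> i + s \<or> j + s < i)}\<rparr>"

lemma pverts_rotational_tournament [simp]: "pverts (rotational_tournament s) = {..2 * s}"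
  by (simp add: rotational_tournament_def)

lemma oriented_rotational_tournament: "oriented_graph (rotational_tournament s)"
  by (auto simp: oriented_graph_iff rotational_tournament_def)

context
  fixes s i :: nat
  assumes i: "i \<le> 2 * s"
begin

lemma card_out_nbhd_rotational_tournament: "card (out_nbhd (rotational_tournament s) i) = s"
\<comment> \<open>For \<open>i \<le> s\<close> the out-neighbours form one interval; otherwise they
  may wrap around past \<open>2 * s\<close> into an initial segment.\<close>
proof (cases "i \<le> s")
  case True
  then have "out_nbhd (rotational_tournament s) i = {i<..i + s}"
    using i by (auto simp: out_nbhd_def rotational_tournament_def)
  then show ?thesis
    by simp
next
  case False
  then have "out_nbhd (rotational_tournament s) i = {i<..2 * s} \<union> {..<i - s}"
    using i by (auto simp: out_nbhd_def rotational_tournament_def)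
  moreover have "card ({i<..2 * s} \<union> {..<i - s}) = 2 * s - i + (i - s)"
    by (subst card_Un_disjoint) auto
  ultimately show ?thesis
    using False i by simp
qed

lemma card_in_nbhd_rotational_tournament: "card (in_nbhd (rotational_tournament s) i) = s"
proof (cases "i \<le> s")
  case True
  then have "in_nbhd (rotational_tournament s) i = {..<i} \<union> {i + s<..2 * s}"
    using i by (auto simp: in_nbhd_def rotational_tournament_def)
  moreover have "card ({..<i} \<union> {i + s<..2 * s}) = i + (2 * s - (i + s))"
    by (subst card_Un_disjoint) auto
  ultimately show ?thesis
    using True by simp
next
  case False
  then have "in_nbhd (rotational_tournament s) i = {i - s..<i}"
    using i by (auto simp: in_nbhd_def rotational_tournament_def)
  then show ?thesis
    using False by simp
qed

text \<open>Outside \<open>i\<close> and its \<open>s\<close> out-neighbours only \<open>s\<close>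
  of the \<open>2 * s + 1\<close> vertices remain.\<close>

lemma card_second_out_nbhd_rotational_tournament:
  "card (second_out_nbhd (rotational_tournament s) i) \<le> s"
proof -
  let ?T = "rotational_tournament s"
  have "card (second_out_nbhd ?T i) \<le> card ({..2 * s} - insert i (out_nbhd ?T i))"
    by (intro card_mono) (auto simp: second_out_nbhd_def)
  also have "\<dots> = card {..2 * s} - card (insert i (out_nbhd ?T i))"
    using i oriented_graph_nbhds[OF oriented_rotational_tournament, of s i]
    by (intro card_Diff_subset) auto
  also have "card (insert i (out_nbhd ?T i)) = Suc s"
    using oriented_graph_nbhds[OF oriented_rotational_tournament, of s i]
    by (subst card_insert_disjoint)
      (auto simp: card_out_nbhd_rotational_tournament, simp add: out_nbhd_def rotational_tournament_def)
  finally show ?thesis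
    by simp
qed

end

text \<open>The substitution adds \<open>s * card (pverts G)\<close> to every in-degree and at most
  that much to every second out-neighbourhood, so the surplus of \<open>G\<close> survives.\<close>

lemma
  fixes G :: "'a pair_pre_digraph"
  assumes "has_surplus c G"
  shows has_surplus_tournament_lex: "has_surplus c (lex_prod_graph (rotational_tournament s) G)"
    and min_out_degree_tournament_lex:
      "s * card (pverts G) \<le> min_out_degree (lex_prod_graph (rotational_tournament s) G)"
proof -
  let ?T = "rotational_tournament s"
  let ?P = "lex_prod_graph ?T G"
  have G: "oriented_graph G"
    using assms by (simp add: has_surplus_def)
  note T = oriented_rotational_tournament[of s]
  have P: "oriented_graph ?P"
    using T G by (rule oriented_lex_prod_graph)
  show "has_surplus c ?P"
    unfolding has_surplus_def
  proof (intro conjI ballI P)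
    fix v
    assume "v \<in> pverts ?P"
    then obtain i x where v: "v = (i, x)" "i \<in> pverts ?T" "x \<in> pverts G"
      by (cases v) auto
    have "card (second_out_nbhd ?P v) + c
        \<le> card (second_out_nbhd ?T i) * card (pverts G) + card (second_out_nbhd G x) + c"
      using card_second_out_nbhd_lex_prod_graph[OF T G v(2,3)] v(1) by simp
    also have "\<dots> \<le> s * card (pverts G) + card (second_out_nbhd G x) + c"
      using card_second_out_nbhd_rotational_tournament[of i s] v(2) by simp
    also have "\<dots> < s * card (pverts G) + card (in_nbhd G x)"
      using assms v(3) by (simp add: has_surplus_def)
    also have "\<dots> = card (in_nbhd ?P v)"
      using card_in_nbhd_lex_prod_graph[OF T G v(2,3)]
        card_in_nbhd_rotational_tournament[of i s] v(1,2) by simp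
    finally show "card (second_out_nbhd ?P v) + c < card (in_nbhd ?P v)" .
  qed
  have "s * card (pverts G) \<le> card (out_nbhd ?P v)" if "v \<in> pverts ?P" for v
  proof -
    from that obtain i x where v: "v = (i, x)" "i \<in> pverts ?T" "x \<in> pverts G"
      by (cases v) auto
    then show ?thesis
      using card_out_nbhd_lex_prod_graph[OF T G v(2,3)]
        card_out_nbhd_rotational_tournament[of i s] by simp
  qed
  then show "s * card (pverts G) \<le> min_out_degree ?P"
    using P unfolding min_out_degree_def oriented_graph_iff by (subst Min_ge_iff) auto
qed

section \<open>Strong connectivity\<close>

text \<open>No vertex of \<open>S\<close> loses an in-neighbour. A vertex of \<open>S\<close> that
  is not an out-neighbour in the induced graph is not one in \<open>G\<close>, so no new second
  out-neighbour arises.\<close>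

lemma has_surplus_in_closed:
  assumes "has_surplus c G" and S: "S \<subseteq> pverts G" "S \<noteq> {}"
    and closed: "\<And>u v. (u, v) \<in> parcs G \<Longrightarrow> v \<in> S \<Longrightarrow> u \<in> S"
  shows "has_surplus c \<lparr>pverts = S, parcs = parcs G \<inter> S \<times> S\<rparr>" (is "has_surplus c ?H")
  unfolding has_surplus_def
proof (intro conjI ballI)
  have G: "oriented_graph G"
    using assms by (simp add: has_surplus_def)
  then show "oriented_graph ?H"
    using S unfolding oriented_graph_iff by (auto intro: finite_subset)
  fix v
  assume "v \<in> pverts ?H"
  then have v: "v \<in> S"
    by simp
  have "second_out_nbhd ?H v \<subseteq> second_out_nbhd G v"
    using v S by (auto simp: second_out_nbhd_def out_nbhd_def)
  then have "card (second_out_nbhd ?H v) \<le> card (second_out_nbhd G v)"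
    using oriented_graph_nbhds[OF G] by (simp add: card_mono)
  moreover have "in_nbhd ?H v = in_nbhd G v"
    using v closed by (auto simp: in_nbhd_def)
  ultimately show "card (second_out_nbhd ?H v) + c < card (in_nbhd ?H v)"
    using assms(1) v S(1) by (fastforce simp: has_surplus_def)
qed

text \<open>\<open>H\<close> has the fewest vertices among all graphs over \<open>'a\<close> with
  this surplus. The vertices not reachable from \<open>u\<close> are closed under in-neighbours and
  omit \<open>u\<close>, so if there were any they would induce a smaller such graph.\<close>

lemma has_surplus_strongly_connected:
  fixes G :: "'a pair_pre_digraph"
  assumes "has_surplus c G"
  obtains H :: "'a pair_pre_digraph" where "has_surplus c H"
    "\<And>u v. u \<in> pverts H \<Longrightarrow> v \<in> pverts H \<Longrightarrow> (u, v) \<in> (parcs H)\<^sup>*"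
proof -
  obtain H :: "'a pair_pre_digraph" where H: "has_surplus c H"
    and least: "\<And>K :: 'a pair_pre_digraph. has_surplus c K \<Longrightarrow> card (pverts H) \<le> card (pverts K)"
    using ex_has_least_nat[of "has_surplus c" G "\<lambda>K. card (pverts K)"] assms by blast
  have "(u, v) \<in> (parcs H)\<^sup>*" if uv: "u \<in> pverts H" "v \<in> pverts H" for u v
  proof (rule ccontr)
    assume not: "(u, v) \<notin> (parcs H)\<^sup>*"
    define S where "S = {w \<in> pverts H. (u, w) \<notin> (parcs H)\<^sup>*}"
    have fin: "finite (pverts H)" and wf: "parcs H \<subseteq> pverts H \<times> pverts H"
      using H by (auto simp: has_surplus_def oriented_graph_iff)
    have "has_surplus c \<lparr>pverts = S, parcs = parcs H \<inter> S \<times> S\<rparr>"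
    proof (rule has_surplus_in_closed[OF H])
      show "S \<subseteq> pverts H" "S \<noteq> {}"
        using uv not by (auto simp: S_def)
      show "x \<in> S" if "(x, y) \<in> parcs H" "y \<in> S" for x y
        using that wf by (auto simp: S_def intro: rtrancl_into_rtrancl)
    qed
    then have "card (pverts H) \<le> card S"
      using least by fastforce
    moreover have "S \<subset> pverts H"
      using uv by (auto simp: S_def)
    ultimately show False
      using psubset_card_mono[OF fin, of S] by simp
  qed
  with H that show thesis
    by blast
qed

section \<open>The ring of copies joined by connectors\<close>

text \<open>The vertex \<open>(i, None)\<close> is the connector \<open>z\<^sub>i\<close> leaving the \<open>i\<close>-th copy of \<open>G\<close>.\<close>
definition ring_graph :: "nat \<Rightarrow> 'a pair_pre_digraph \<Rightarrow> 'a \<Rightarrow> (nat \<times> 'a option) pair_pre_digraph"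
  where
  "ring_graph t G r = \<lparr>pverts = {..<t} \<times> insert None (Some ` pverts G),
     parcs = {((i, Some x), (i, Some y)) | i x y. i < t \<and> (x, y) \<in> parcs G} \<union>
       {((i, Some x), (i, None)) | i x. i < t \<and> x \<in> pverts G} \<union>
       {((i, None), (Suc i mod t, Some r)) | i. i < t}\<rparr>"

lemma pverts_ring_graph [simp]:
  "pverts (ring_graph t G r) = {..<t} \<times> insert None (Some ` pverts G)"
  by (simp add: ring_graph_def)

lemma parcs_ring_graph_iff:
  "((i, Some x), (j, Some y)) \<in> parcs (ring_graph t G r) \<longleftrightarrow> i < t \<and> i = j \<and> (x, y) \<in> parcs G"
  "((i, Some x), (j, None)) \<in> parcs (ring_graph t G r) \<longleftrightarrow> i < t \<and> i = j \<and> x \<in> pverts G"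
  "((i, None), (j, Some y)) \<in> parcs (ring_graph t G r) \<longleftrightarrow> i < t \<and> j = Suc i mod t \<and> y = r"
  "((i, None), (j, None)) \<notin> parcs (ring_graph t G r)"
  by (auto simp: ring_graph_def)

context
  fixes G :: "'a pair_pre_digraph" and r :: 'a and t :: nat
  assumes surplus: "has_surplus 1 G" and r: "r \<in> pverts G" and t: "2 \<le> t"
begin

lemma oriented_ring_base: "oriented_graph G"
  using surplus by (simp add: has_surplus_def)

lemma oriented_ring_graph: "oriented_graph (ring_graph t G r)"
proof -
  have G: "finite (pverts G)" "parcs G \<subseteq> pverts G \<times> pverts G"
    "\<And>u v. (u, v) \<in> parcs G \<Longrightarrow> (v, u) \<notin> parcs G"
    using oriented_ring_base by (auto simp: oriented_graph_iff)
  \<comment> \<open>For \<open>t = 1\<close> the connector would point back into its own copy and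
    form a 2-cycle with \<open>r\<close>; \<open>2 \<le> t\<close> prevents this.\<close>
  have next_neq: "Suc i mod t \<noteq> i" if "i < t" for i
    using t that by (cases "Suc i = t") auto
  have "parcs (ring_graph t G r) \<subseteq> pverts (ring_graph t G r) \<times> pverts (ring_graph t G r)"
    using G(2) r t by (auto simp: ring_graph_def)
  moreover have "(v, u) \<notin> parcs (ring_graph t G r)" if "(u, v) \<in> parcs (ring_graph t G r)" for u v
  proof -
    obtain i a j b where "u = (i, a)" "v = (j, b)"
      by (metis surj_pair)
    then show ?thesis
      using that G(3) next_neq[of i] next_neq[of j]
      by (cases a; cases b) (auto simp: parcs_ring_graph_iff)
  qed
  ultimately show ?thesis
    using G(1) t by (auto simp: oriented_graph_iff lessThan_empty_iff)
qed

text \<open>The only way out of a copy is its connector, already a first out-neighbour, whose single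
  out-neighbour is the entry vertex of the next copy.\<close>

lemma second_out_nbhd_ring_copy:
  assumes "i < t" "x \<in> pverts G"
  shows "second_out_nbhd (ring_graph t G r) (i, Some x) \<subseteq>
     insert (Suc i mod t, Some r) ((\<lambda>y. (i, Some y)) ` second_out_nbhd G x)"
proof
  fix w
  assume w: "w \<in> second_out_nbhd (ring_graph t G r) (i, Some x)"
  then obtain j b k c where jb: "w = (j, b)" "((i, Some x), (k, c)) \<in> parcs (ring_graph t G r)"
    "((k, c), (j, b)) \<in> parcs (ring_graph t G r)"
    by (cases w) (auto simp: second_out_nbhd_def out_nbhd_def)
  show "w \<in> insert (Suc i mod t, Some r) ((\<lambda>y. (i, Some y)) ` second_out_nbhd G x)"
    using w jb assms
    by (cases b; cases c)
      (auto simp: second_out_nbhd_def out_nbhd_def parcs_ring_graph_iff)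
qed

lemma second_out_nbhd_ring_connector:
  "second_out_nbhd (ring_graph t G r) (i, None) \<subseteq>
     Pair (Suc i mod t) ` insert None (Some ` out_nbhd G r)"
proof
  fix w
  assume "w \<in> second_out_nbhd (ring_graph t G r) (i, None)"
  then obtain j b k c where jb: "w = (j, b)" "((i, None), (k, c)) \<in> parcs (ring_graph t G r)"
    "((k, c), (j, b)) \<in> parcs (ring_graph t G r)"
    by (cases w) (auto simp: second_out_nbhd_def out_nbhd_def)
  then show "w \<in> Pair (Suc i mod t) ` insert None (Some ` out_nbhd G r)"
    by (cases b; cases c) (auto simp: out_nbhd_def parcs_ring_graph_iff)
qed

lemma sullivan_counterexample_ring_graph: "sullivan_counterexample (ring_graph t G r)"
  unfolding sullivan_counterexample_def
proof (intro conjI ballI oriented_ring_graph)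
  let ?R = "ring_graph t G r"
  note G = oriented_ring_base
  fix v
  assume "v \<in> pverts ?R"
  then consider i x where "v = (i, Some x)" "i < t" "x \<in> pverts G" | i where "v = (i, None)" "i < t"
    by auto
  then show "card (second_out_nbhd ?R v) < card (in_nbhd ?R v)"
  proof cases
    case (1 i x)
    note nb = oriented_graph_nbhds[OF G, of x]
    have "card (second_out_nbhd ?R v) \<le>
        card (insert (Suc i mod t, Some r) ((\<lambda>y. (i, Some y)) ` second_out_nbhd G x))"
      unfolding 1(1) using nb second_out_nbhd_ring_copy[OF 1(2,3)] by (intro card_mono) auto
    also have "\<dots> \<le> Suc (card ((\<lambda>y. (i, Some y)) ` second_out_nbhd G x))"
      by (rule card_insert_le_m1) simp_all
    also have "\<dots> \<le> Suc (card (second_out_nbhd G x))"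
      using nb by (simp add: card_image_le)
    also have "\<dots> < card (in_nbhd G x)"
      using surplus 1(3) by (simp add: has_surplus_def)
    also have "\<dots> = card ((\<lambda>y. (i, Some y)) ` in_nbhd G x)"
      by (intro card_image[symmetric]) (auto simp: inj_on_def)
    \<comment> \<open>The in-degree grows at \<open>x = r\<close>, which also receives an arc from
      the preceding connector.\<close>
    also have "\<dots> \<le> card (in_nbhd ?R v)"
      using 1 oriented_graph_nbhds(5)[OF oriented_ring_graph, of v]
      by (intro card_mono) (auto simp: in_nbhd_def parcs_ring_graph_iff)
    finally show ?thesis .
  next
    case (2 i)
    note nb = oriented_graph_nbhds[OF G, of r]
    have "card (second_out_nbhd ?R v) \<le>
        card (Pair (Suc i mod t) ` insert None (Some ` out_nbhd G r))"
      unfolding 2(1) using nb second_out_nbhd_ring_connector by (intro card_mono) auto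
    also have "\<dots> \<le> card (insert None (Some ` out_nbhd G r))"
      using nb by (intro card_image_le) simp
    also have "\<dots> = Suc (card (out_nbhd G r))"
      using nb by (subst card_insert_disjoint) (auto simp: card_image)
    \<comment> \<open>By the surplus \<open>r\<close> has in-neighbours, so the degree sum keeps its
      out-degree plus one below the order of \<open>G\<close>.\<close>
    also have "\<dots> < card (pverts G)"
      using oriented_graph_degree_sum[OF G r] surplus r by (fastforce simp: has_surplus_def)
    also have "\<dots> = card ((\<lambda>y. (i, Some y)) ` pverts G)"
      by (intro card_image[symmetric]) (auto simp: inj_on_def)
    also have "\<dots> \<le> card (in_nbhd ?R v)"
      using 2 oriented_graph_nbhds(5)[OF oriented_ring_graph, of v]
      by (intro card_mono) (auto simp: in_nbhd_def parcs_ring_graph_iff)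
    finally show ?thesis .
  qed
qed

text \<open>Each out-neighbourhood lies within one copy and its connector, which makes the bound
  independent of \<open>t\<close>.\<close>

lemma max_out_degree_ring_graph: "max_out_degree (ring_graph t G r) \<le> Suc (card (pverts G))"
proof -
  let ?R = "ring_graph t G r"
  have finV: "finite (pverts G)" and wf: "parcs G \<subseteq> pverts G \<times> pverts G"
    using oriented_ring_base by (auto simp: oriented_graph_iff)
  have "card (out_nbhd ?R v) \<le> Suc (card (pverts G))" for v
  proof -
    obtain i b where v: "v = (i, b)"
      by fastforce
    have "\<exists>j. out_nbhd ?R v \<subseteq> Pair j ` insert None (Some ` pverts G)"
      using wf r unfolding v by (cases b) (auto simp: out_nbhd_def ring_graph_def)
    then obtain j where "out_nbhd ?R v \<subseteq> Pair j ` insert None (Some ` pverts G)" ..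
    then have "card (out_nbhd ?R v) \<le> card (insert None (Some ` pverts G))"
      using finV by (intro surj_card_le[rotated]) auto
    also have "\<dots> = Suc (card (pverts G))"
      using finV by (subst card_insert_disjoint) (auto simp: card_image)
    finally show ?thesis .
  qed
  then show ?thesis
    using oriented_ring_graph unfolding max_out_degree_def oriented_graph_iff
    by (subst Max_le_iff) auto
qed

text \<open>A walk goes to the connector of its own copy, then around the ring to the connector just
  before the target copy, and enters there.\<close>

lemma ring_graph_reachable:
  assumes reach: "\<And>u v. u \<in> pverts G \<Longrightarrow> v \<in> pverts G \<Longrightarrow> (u, v) \<in> (parcs G)\<^sup>*"
    and "u \<in> pverts (ring_graph t G r)" "v \<in> pverts (ring_graph t G r)"
  shows "(u, v) \<in> (parcs (ring_graph t G r))\<^sup>*"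
proof -
  let ?A = "(parcs (ring_graph t G r))\<^sup>*"
  have copy: "((i, Some x), (i, Some y)) \<in> ?A" if "i < t" "(x, y) \<in> (parcs G)\<^sup>*" for i x y
    using that(2)
  proof induction
    case (step y z)
    then show ?case
      using that(1) by (auto simp: parcs_ring_graph_iff intro: rtrancl_into_rtrancl)
  qed simp
  have to_connector: "((i, b), (i, None)) \<in> ?A" if "(i, b) \<in> pverts (ring_graph t G r)" for i b
    using that by (cases b) (auto simp: parcs_ring_graph_iff)
  have enter: "((i, None), (Suc i mod t, b)) \<in> ?A"
    if "i < t" "(Suc i mod t, b) \<in> pverts (ring_graph t G r)" for i b
  proof -
    have Si: "Suc i mod t < t"
      using t by simp
    have first: "((i, None), (Suc i mod t, Some r)) \<in> ?A"
      using that by (auto simp: parcs_ring_graph_iff)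
    show ?thesis
    proof (cases b)
      case None
      with first Si r to_connector[of "Suc i mod t" "Some r"] show ?thesis
        by (auto intro: rtrancl_trans)
    next
      case (Some y)
      with that have "y \<in> pverts G"
        by auto
      with first Some copy[OF Si reach[OF r]] show ?thesis
        by (auto intro: rtrancl_trans)
    qed
  qed
  have round_trip: "((i, None), ((i + k) mod t, None)) \<in> ?A" if "i < t" for i k
  proof (induction k)
    case (Suc k)
    have "(((i + k) mod t, None), (Suc ((i + k) mod t) mod t, None)) \<in> ?A"
      using t by (intro enter) auto
    with Suc show ?case
      by (auto simp: mod_Suc_eq intro: rtrancl_trans)
  qed (use that in simp)
  obtain i a j b where uv: "u = (i, a)" "v = (j, b)" "i < t" "j < t"
    using assms(2,3) by auto
  \<comment> \<open>Thus \<open>i + k = j + t - 1\<close>, the index before \<open>j\<close> modulo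
    \<open>t\<close>; the summand \<open>t\<close> keeps the subtraction from truncating, as
    \<open>i < t\<close>.\<close>
  define k where "k = j + t - 1 - i"
  have k: "Suc ((i + k) mod t) mod t = j"
    using uv(3,4) by (simp add: k_def mod_Suc_eq)
  have "(u, (i, None)) \<in> ?A"
    using to_connector assms(2) uv(1) by blast
  also have "((i, None), ((i + k) mod t, None)) \<in> ?A"
    using round_trip uv(3) .
  also have "(((i + k) mod t, None), v) \<in> ?A"
    using enter[of "(i + k) mod t" b] assms(3) t uv(2) k by simp
  finally show ?thesis .
qed

end

section \<open>The two families of counterexamples over \<open>nat\<close>\<close>

theorem corollary6p11:
  assumes "\<not> sullivan_conjecture TYPE('a)"
  shows "\<exists>k :: nat.
    (\<forall>N :: nat. \<exists>H :: nat pair_pre_digraph.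
       sullivan_counterexample H \<and> strongly_connected (with_proj H) \<and>
       N \<le> card (pverts H) \<and> max_out_degree H \<le> k) \<and>
    (\<forall>N :: nat. \<exists>H :: nat pair_pre_digraph.
       sullivan_counterexample H \<and>
       N \<le> card (pverts H) \<and>
       real (min_out_degree H) \<ge> real (card (pverts H)) / 2 - real k)"
proof -
  obtain G\<^sub>0 :: "'a pair_pre_digraph" where "has_surplus 0 G\<^sub>0"
    using assms
    by (auto simp: sullivan_conjecture_def sullivan_counterexample_def not_le
        simp flip: sullivan_counterexample_iff)
  \<comment> \<open>Doubling comes first, because the smallest graph must itself have the larger
    surplus.\<close>
  from has_surplus_strongly_connected[OF has_surplus_double[OF this]]
  obtain H :: "('a \<times> bool) pair_pre_digraph" where H: "has_surplus 1 H"
    and reach_H: "\<And>u v. u \<in> pverts H \<Longrightarrow> v \<in> pverts H \<Longrightarrow> (u, v) \<in> (parcs H)\<^sup>*"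
    by blast
  have oriented_H: "oriented_graph H"
    using H by (simp add: has_surplus_def)
  \<comment> \<open>The type \<open>'a\<close> may be uncountable, but \<open>pverts H\<close> is
    finite. Once the vertices are naturals, \<open>to_nat\<close> relabels the rings and
    products.\<close>
  then obtain f :: "'a \<times> bool \<Rightarrow> nat" where f: "inj_on f (pverts H)"
    using finite_imp_inj_to_nat_seg[of "pverts H"] unfolding oriented_graph_iff by blast
  define G where "G = map_graph f H"
  have G: "has_surplus 1 G"
    unfolding G_def using oriented_H f H by (rule has_surplus_map_graph)
  have reach: "(u, v) \<in> (parcs G)\<^sup>*" if "u \<in> pverts G" "v \<in> pverts G" for u v
    using that reach_H by (auto simp: G_def intro: rtrancl_map_graph)
  have finV: "finite (pverts G)" and "pverts G \<noteq> {}"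
    using G by (auto simp: has_surplus_def oriented_graph_iff)
  then obtain r where r: "r \<in> pverts G"
    by blast
  \<comment> \<open>One constant for both families: it bounds the out-degrees in the rings and
    exceeds the defect \<open>card (pverts G) / 2\<close> of the products.\<close>
  let ?k = "Suc (card (pverts G))"
  have "\<exists>H :: nat pair_pre_digraph. sullivan_counterexample H \<and> strongly_connected (with_proj H) \<and>
      N \<le> card (pverts H) \<and> max_out_degree H \<le> ?k" for N
  proof -
    \<comment> \<open>\<open>N + 2\<close> copies give at least \<open>N\<close> vertices and also
      meet the requirement \<open>2 \<le> t\<close>.\<close>
    define R where "R = ring_graph (N + 2) G r"
    define K where "K = map_graph to_nat R"
    have R: "oriented_graph R" "has_surplus 0 R"
      using oriented_ring_graph[OF G r, of "N + 2"]
        sullivan_counterexample_ring_graph[OF G r, of "N + 2"]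
      by (simp_all add: R_def sullivan_counterexample_iff)
    have inj: "inj_on to_nat (pverts R)"
      by (simp add: inj_on_def)
    have "sullivan_counterexample K"
      unfolding sullivan_counterexample_iff K_def
      using R(1) inj R(2) by (rule has_surplus_map_graph)
    moreover have "strongly_connected (with_proj K)"
    proof (rule strongly_connected_with_projI)
      show "oriented_graph K"
        unfolding K_def using R(1) inj by (rule oriented_map_graph)
      fix u v
      assume "u \<in> pverts K" "v \<in> pverts K"
      then obtain u' v' where "u = to_nat u'" "v = to_nat v'" "u' \<in> pverts R" "v' \<in> pverts R"
        by (auto simp: K_def)
      moreover from this have "(u', v') \<in> (parcs R)\<^sup>*"
        unfolding R_def by (intro ring_graph_reachable[OF G r _ reach]) auto
      ultimately show "(u, v) \<in> (parcs K)\<^sup>*"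
        by (simp add: K_def rtrancl_map_graph)
    qed
    moreover have "N \<le> card (pverts K)"
      using finV inj
      by (simp add: K_def R_def card_image card_cartesian_product card_insert_disjoint)
    moreover have "max_out_degree K \<le> ?k"
      using max_out_degree_ring_graph[OF G r, of "N + 2"] R(1) inj
      by (simp add: K_def max_out_degree_map_graph R_def)
    ultimately show ?thesis
      by blast
  qed
  moreover have "\<exists>H :: nat pair_pre_digraph. sullivan_counterexample H \<and> N \<le> card (pverts H) \<and>
      real (min_out_degree H) \<ge> real (card (pverts H)) / 2 - real ?k" for N
  proof -
    define P where "P = lex_prod_graph (rotational_tournament N) G"
    define K where "K = map_graph to_nat P"
    have P: "has_surplus 0 P" "N * card (pverts G) \<le> min_out_degree P"
      unfolding P_def using has_surplus_tournament_lex min_out_degree_tournament_lex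
        has_surplus_mono[OF G] by blast+
    have oP: "oriented_graph P"
      using P(1) by (simp add: has_surplus_def)
    have inj: "inj_on to_nat (pverts P)"
      by (simp add: inj_on_def)
    have "sullivan_counterexample K"
      unfolding sullivan_counterexample_iff K_def
      using oP inj P(1) by (rule has_surplus_map_graph)
    moreover have cK: "card (pverts K) = (2 * N + 1) * card (pverts G)"
      using inj by (simp add: K_def card_image) (simp add: P_def card_cartesian_product)
    moreover have "N \<le> (2 * N + 1) * card (pverts G)"
      using finV r by (cases "card (pverts G)") auto
    \<comment> \<open>Half the order is \<open>N * card (pverts G)\<close> plus
      \<open>card (pverts G) / 2\<close>, and the second summand is less than
      \<open>?k\<close>.\<close>
    moreover have "real (card (pverts K)) / 2 - real ?k \<le> real (min_out_degree K)"
    proof -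
      have "real (N * card (pverts G)) \<le> real (min_out_degree K)"
        using P(2) oP inj unfolding K_def by (simp only: min_out_degree_map_graph of_nat_le_iff)
      then show ?thesis
        unfolding cK by (simp add: field_simps)
    qed
    ultimately show ?thesis
      by metis
  qed
  ultimately show ?thesis
    by blast
qed

end
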